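(* Let $(X,\mathcal A)$ be a measurable space, $\mu$ a continuous monotone measure on $\mathcal A$, $A\in\mathcal A$, and let $\star\colon[0,\infty)\times(-\infty,0]\to\mathbb R$ be a nondecreasing map. Let $H\colon\mathbb R\to\mathbb R$ be a nondecreasing function with $H(0)=0$. Then for every $\mathcal A$-measurable $f\colon X\to\mathbb R$ such that $p_1:=\mathrm{Su}(f^+;A,\mu)$ and $p_2:=\mathrm{Su}(f^-;A,\mu)$ are finite and $p_1\le\sup_{y\in\mathbb R}H(y)$, we have $$\mathrm{Su}^{\star}_{\mu,A}(H(f))\ \le\ \Big[\big(H(p_1)\vee p_1\big)\wedge\mu(A)\Big]\star\Big[H(-p_2)\vee(-p_2)\Big].$$ The inequality is sharp: equality holds for $f=\mu(B)\mathbf 1_B-\mu(A\setminus B)\mathbf 1_{A\setminus B}$ whenever $B\in\mathcal A$, $B\subset A$, $\mu(B)<\infty$, $\mu(A\setminus B)<\infty$ and $H(\mu(B))=\mu(B)$.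
   Context: A monotone measure on $\mathcal A$ is a set function $\mu\colon\mathcal A\to[0,\infty]$ with $\mu(\emptyset)=0$ and $\mu(B)\le\mu(C)$ whenever $B\subset C$. It is continuous if $\lim_n\mu(A_n)=\mu(\lim_n A_n)$ for every increasing sequence $(A_n)$ in $\mathcal A$ (with $\lim_n A_n=\bigcup_nA_n$) and for every decreasing sequence $(A_n)$ in $\mathcal A$ (with $\lim_nA_n=\bigcap_nA_n$). The map $\star$ is nondecreasing if $a\star b\le c\star d$ whenever $a\le c$ and $b\le d$. Notation: $a\wedge b=\min(a,b)$, $a\vee b=\max(a,b)$; $f^+=f\vee0$, $f^-=(-f)\vee0$; $\mathbf 1_B$ is the indicator function of $B$. Sugeno integral: for measurable $g\colon X\to[0,\infty]$, $\mathrm{Su}(g;A,\mu)=\sup_{t\ge0}\{t\wedge\mu(A\cap\{g\ge t\})\}$, where $\{g\ge t\}=\{x\in X:g(x)\ge t\}$. $\star$-symmetric Sugeno integral: for measurable $g\colon X\to\mathbb R$ with $\mathrm{Su}(g^+;A,\mu)<\infty$ and $\mathrm{Su}(g^-;A,\mu)<\infty$, $$\mathrm{Su}^{\star}_{\mu,A}(g)=\mathrm{Su}(g^+;A,\mu)\star\big(-\mathrm{Su}(g^-;A,\mu)\big).$$ *)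

theory Defs
  imports "HOL-Analysis.Analysis"
begin

text \<open>
  A value \<open>M :: 'a measure\<close> serves below only as the measurable space
  \<open>(space M, sets M)\<close>; its own measure is never used.  The set function \<open>\<mu>\<close> is a
  separate object, constrained only on \<open>sets M\<close>.
\<close>

definition monotone_measure :: "'a measure \<Rightarrow> ('a set \<Rightarrow> ennreal) \<Rightarrow> bool" where
  "monotone_measure M \<mu> \<longleftrightarrow>
     \<mu> {} = 0 \<and> (\<forall>B\<in>sets M. \<forall>C\<in>sets M. B \<subseteq> C \<longrightarrow> \<mu> B \<le> \<mu> C)"

text \<open>Continuity from above is required without any finiteness restriction.\<close>

definition continuous_set_function :: "'a measure \<Rightarrow> ('a set \<Rightarrow> ennreal) \<Rightarrow> bool" where
  "continuous_set_function M \<mu> \<longleftrightarrow>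
     (\<forall>S :: nat \<Rightarrow> 'a set. range S \<subseteq> sets M \<longrightarrow> incseq S \<longrightarrow>
        (\<lambda>n. \<mu> (S n)) \<longlonglongrightarrow> \<mu> (\<Union>n. S n)) \<and>
     (\<forall>S :: nat \<Rightarrow> 'a set. range S \<subseteq> sets M \<longrightarrow> decseq S \<longrightarrow>
        (\<lambda>n. \<mu> (S n)) \<longlonglongrightarrow> \<mu> (\<Inter>n. S n))"

definition sugeno ::
    "'a measure \<Rightarrow> ('a set \<Rightarrow> ennreal) \<Rightarrow> 'a set \<Rightarrow> ('a \<Rightarrow> ennreal) \<Rightarrow> ennreal" where
  "sugeno M \<mu> A g =
     (SUP t\<in>{0::real..}. min (ennreal t) (\<mu> (A \<inter> {x \<in> space M. g x \<ge> ennreal t})))"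

definition sugeno_pos ::
    "'a measure \<Rightarrow> ('a set \<Rightarrow> ennreal) \<Rightarrow> 'a set \<Rightarrow> ('a \<Rightarrow> real) \<Rightarrow> ennreal" where
  "sugeno_pos M \<mu> A g = sugeno M \<mu> A (\<lambda>x. ennreal (max (g x) 0))"

definition sugeno_neg ::
    "'a measure \<Rightarrow> ('a set \<Rightarrow> ennreal) \<Rightarrow> 'a set \<Rightarrow> ('a \<Rightarrow> real) \<Rightarrow> ennreal" where
  "sugeno_neg M \<mu> A g = sugeno M \<mu> A (\<lambda>x. ennreal (max (- g x) 0))"

definition sym_sugeno_integrable ::
    "'a measure \<Rightarrow> ('a set \<Rightarrow> ennreal) \<Rightarrow> 'a set \<Rightarrow> ('a \<Rightarrow> real) \<Rightarrow> bool" where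
  "sym_sugeno_integrable M \<mu> A g \<longleftrightarrow>
     g \<in> borel_measurable M \<and> sugeno_pos M \<mu> A g < \<infinity> \<and> sugeno_neg M \<mu> A g < \<infinity>"

text \<open>
  A map on \<open>[0,\<infinity>) \<times> (-\<infinity>,0]\<close> is represented by a total binary function, constrained
  only on that domain.
\<close>

definition nondecreasing_star :: "(real \<Rightarrow> real \<Rightarrow> real) \<Rightarrow> bool" where
  "nondecreasing_star star \<longleftrightarrow>
     (\<forall>a\<in>{0..}. \<forall>c\<in>{0..}. \<forall>b\<in>{..0}. \<forall>d\<in>{..0}.
        a \<le> c \<longrightarrow> b \<le> d \<longrightarrow> star a b \<le> star c d)"

text \<open>Meaningful only for \<open>sym_sugeno_integrable\<close> functions, as \<^term>\<open>enn2real \<infinity> = 0\<close>.\<close>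

definition sym_sugeno ::
    "(real \<Rightarrow> real \<Rightarrow> real) \<Rightarrow> 'a measure \<Rightarrow> ('a set \<Rightarrow> ennreal) \<Rightarrow> 'a set \<Rightarrow> ('a \<Rightarrow> real) \<Rightarrow> real"
  where
  "sym_sugeno star M \<mu> A g =
     star (enn2real (sugeno_pos M \<mu> A g)) (- enn2real (sugeno_neg M \<mu> A g))"

end

theory Submission
  imports Defs
begin

text \<open>
  The negative part of \<open>f\<close> is the positive part of \<open>- f\<close>, and \<open>H (f) = - G (- f)\<close> with
  \<open>G y = - H (- y)\<close>, so both arguments of the star are governed by two bounds for
  nondecreasing \<open>H\<close> and \<open>p = Su (f\<^sup>+)\<close>.  Continuity from below gives
  \<open>\<mu> (A \<inter> {f > p}) \<le> p\<close>; as \<open>{H (f) \<ge> t} \<subseteq> {f > p}\<close> for \<open>t > H p\<close>, the integral of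
  \<open>H (f)\<^sup>+\<close> is at most \<open>max (H p) p\<close>.  Continuity from above gives
  \<open>p \<le> \<mu> (A \<inter> {f \<ge> p})\<close>; as \<open>{f \<ge> p} \<subseteq> {H (f) \<ge> H p}\<close>, it is at least \<open>min (H p) p\<close>.
\<close>

section \<open>Superlevel sets and the Sugeno integral of the positive part\<close>

lemma monotone_measureD:
  assumes "monotone_measure M \<mu>" and "B \<in> sets M" and "C \<in> sets M" and "B \<subseteq> C"
  shows "\<mu> B \<le> \<mu> C"
  using assms by (simp add: monotone_measure_def)

lemma superlevel_sets:
  fixes f :: "'a \<Rightarrow> real"
  assumes "A \<in> sets M" and "f \<in> borel_measurable M"
  shows "A \<inter> {x \<in> space M. t \<le> f x} \<in> sets M" "A \<inter> {x \<in> space M. t < f x} \<in> sets M"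
proof -
  have [measurable]: "f \<in> borel_measurable M"
    by fact
  have "{x \<in> space M. t \<le> f x} \<in> sets M" "{x \<in> space M. t < f x} \<in> sets M"
    by measurable
  then show "A \<inter> {x \<in> space M. t \<le> f x} \<in> sets M" "A \<inter> {x \<in> space M. t < f x} \<in> sets M"
    using assms(1) by auto
qed

lemma sugeno_neg_eq_sugeno_pos: "sugeno_neg M \<mu> A f = sugeno_pos M \<mu> A (\<lambda>x. - f x)"
  by (simp add: sugeno_neg_def sugeno_pos_def)

text \<open>The level 0 contributes only 0 to the supremum, and at a level \<open>t > 0\<close>
  truncating \<open>f\<close> at 0 does not change {f \<ge> t}. Hence later arguments can use the
  level sets of the real function \<open>f\<close> itself.\<close>

lemma sugeno_pos_eq_SUP:
  "sugeno_pos M \<mu> A f = (SUP t\<in>{0<..}. min (ennreal t) (\<mu> (A \<inter> {x \<in> space M. t \<le> f x})))"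
proof -
  have eq: "{x \<in> space M. ennreal t \<le> ennreal (max (f x) 0)} = {x \<in> space M. t \<le> f x}"
    if "0 < t" for t
    using that by (auto simp: ennreal_le_iff2)
  have "{0::real..} = insert 0 {0<..}"
    by auto
  then have "sugeno_pos M \<mu> A f = (SUP t\<in>{0<..}. min (ennreal t)
      (\<mu> (A \<inter> {x \<in> space M. ennreal t \<le> ennreal (max (f x) 0)})))"
    unfolding sugeno_pos_def sugeno_def by (simp only: SUP_insert) (simp add: sup_absorb2)
  also have "\<dots> = (SUP t\<in>{0<..}. min (ennreal t) (\<mu> (A \<inter> {x \<in> space M. t \<le> f x})))"
    by (intro SUP_cong refl) (simp only: eq greaterThan_iff)
  finally show ?thesis .
qed

lemma sugeno_pos_upper:
  assumes "0 < t"
  shows "min (ennreal t) (\<mu> (A \<inter> {x \<in> space M. t \<le> f x})) \<le> sugeno_pos M \<mu> A f"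
  unfolding sugeno_pos_eq_SUP using assms by (intro SUP_upper) auto

text \<open>The term at level \<open>t\<close> is at most the integral, which lies below
  \<open>t\<close>; so the minimum in that term cannot be \<open>t\<close> and has to be the
  measure.\<close>

lemma measure_le_of_sugeno_pos_less:
  assumes "sugeno_pos M \<mu> A f < ennreal t"
  shows "\<mu> (A \<inter> {x \<in> space M. t \<le> f x}) \<le> sugeno_pos M \<mu> A f"
proof -
  \<comment> \<open>For nonpositive \<open>t\<close> the value \<open>ennreal t\<close> is 0, and
    nothing lies strictly below 0.\<close>
  have "0 < t"
    using assms by (metis ennreal_neg not_le not_less_zero)
  from sugeno_pos_upper[OF this, of \<mu> A M f] assms show ?thesis
    by (auto simp: min_le_iff_disj)
qed

text \<open>Some term of the supremum exceeds \<open>s\<close>, so both its level \<open>t\<close>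
  and its measure do; lowering the level from \<open>t\<close> to \<open>s\<close> only enlarges the
  set.\<close>

lemma measure_gt_of_less_sugeno_pos:
  assumes mu: "monotone_measure M \<mu>" and A: "A \<in> sets M" and f: "f \<in> borel_measurable M"
    and less: "ennreal s < sugeno_pos M \<mu> A f" and "0 \<le> s"
  shows "ennreal s < \<mu> (A \<inter> {x \<in> space M. s \<le> f x})"
proof -
  from less obtain t where t: "ennreal s < ennreal t"
    "ennreal s < \<mu> (A \<inter> {x \<in> space M. t \<le> f x})"
    unfolding sugeno_pos_eq_SUP less_SUP_iff by auto
  then have "s < t"
    using \<open>0 \<le> s\<close> by (simp add: ennreal_less_iff)
  have "\<mu> (A \<inter> {x \<in> space M. t \<le> f x}) \<le> \<mu> (A \<inter> {x \<in> space M. s \<le> f x})"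
    using \<open>s < t\<close> by (intro monotone_measureD[OF mu] superlevel_sets A f) auto
  with t(2) show ?thesis
    by (rule less_le_trans)
qed

section \<open>Comparison of the integral with the measures of the set and of the superlevel sets at
  its value\<close>

lemma measure_greater_sugeno_pos_le:
  assumes cont: "continuous_set_function M \<mu>" and A: "A \<in> sets M"
    and f: "f \<in> borel_measurable M" and p: "sugeno_pos M \<mu> A f = ennreal p" "0 \<le> p"
  shows "\<mu> (A \<inter> {x \<in> space M. p < f x}) \<le> ennreal p"
proof -
  \<comment> \<open>These sets increase to {f > p}, and each of their levels lies strictly above the
    integral, where the measure is already known to be at most \<open>p\<close>.\<close>
  define S where "S n = A \<inter> {x \<in> space M. p + 1 / real (Suc n) \<le> f x}" for n
  have "range S \<subseteq> sets M"
    using superlevel_sets[OF A f] by (auto simp: S_def)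
  moreover have "incseq S"
  proof (rule incseq_SucI)
    fix n
    have "1 / real (Suc (Suc n)) \<le> 1 / real (Suc n)"
      by (simp add: frac_le)
    then show "S n \<subseteq> S (Suc n)"
      by (auto simp: S_def)
  qed
  ultimately have S_lim: "(\<lambda>n. \<mu> (S n)) \<longlonglongrightarrow> \<mu> (\<Union>n. S n)"
    using cont unfolding continuous_set_function_def by blast
  have S_Union: "(\<Union>n. S n) = A \<inter> {x \<in> space M. p < f x}"
  proof -
    have "(\<exists>n. p + 1 / real (Suc n) \<le> y) \<longleftrightarrow> p < y" for y
    proof
      assume "\<exists>n. p + 1 / real (Suc n) \<le> y"
      then obtain n where "p + 1 / real (Suc n) \<le> y" ..
      moreover have "0 < 1 / real (Suc n)"
        by simp
      ultimately show "p < y"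
        by linarith
    next
      assume "p < y"
      then obtain n where "inverse (real (Suc n)) < y - p"
        using reals_Archimedean[of "y - p"] by auto
      then have "p + 1 / real (Suc n) \<le> y"
        by (simp add: inverse_eq_divide)
      then show "\<exists>n. p + 1 / real (Suc n) \<le> y" ..
    qed
    then show ?thesis
      by (simp add: S_def set_eq_iff del: of_nat_Suc)
  qed
  have S_le: "\<mu> (S n) \<le> ennreal p" for n
  proof -
    have "sugeno_pos M \<mu> A f < ennreal (p + 1 / real (Suc n))"
      using p by (simp add: ennreal_less_iff)
    from measure_le_of_sugeno_pos_less[OF this] show ?thesis
      by (simp add: S_def p)
  qed
  show ?thesis
    by (rule LIMSEQ_le_const2[OF S_lim[unfolded S_Union]]) (use S_le in blast)
qed

lemma sugeno_pos_le_measure_ge: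
  assumes mu: "monotone_measure M \<mu>" and cont: "continuous_set_function M \<mu>"
    and A: "A \<in> sets M" and f: "f \<in> borel_measurable M"
    and p: "sugeno_pos M \<mu> A f = ennreal p" "0 < p"
  shows "ennreal p \<le> \<mu> (A \<inter> {x \<in> space M. p \<le> f x})"
proof -
  \<comment> \<open>Subtracting a fraction of \<open>p\<close> keeps every level in [0, p), starting
    with \<open>s 0 = 0\<close>; this is the range where the strict lower estimate of the measure
    applies.\<close>
  define s where "s n = p - p / real (Suc n)" for n
  define S where "S n = A \<inter> {x \<in> space M. s n \<le> f x}" for n
  have s_mono: "s n \<le> s (Suc n)" for n
    using p by (simp add: s_def frac_le)
  have s_lim: "s \<longlonglongrightarrow> p"
  proof -
    have "(\<lambda>n. p - p * inverse (real (Suc n))) \<longlonglongrightarrow> p - p * 0"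
      by (intro tendsto_intros LIMSEQ_inverse_real_of_nat)
    then show ?thesis
      unfolding s_def divide_inverse by simp
  qed
  have s_bounds: "0 \<le> s n" "s n < p" for n
    using p by (auto simp: s_def field_simps)
  have "range S \<subseteq> sets M"
    using superlevel_sets[OF A f] by (auto simp: S_def)
  moreover have "decseq S"
  proof (rule decseq_SucI)
    show "S (Suc n) \<subseteq> S n" for n
      using s_mono[of n] by (auto simp: S_def)
  qed
  ultimately have S_lim: "(\<lambda>n. \<mu> (S n)) \<longlonglongrightarrow> \<mu> (\<Inter>n. S n)"
    using cont unfolding continuous_set_function_def by blast
  have S_Inter: "(\<Inter>n. S n) = A \<inter> {x \<in> space M. p \<le> f x}"
  proof -
    have "(\<forall>n. s n \<le> y) \<longleftrightarrow> p \<le> y" for y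
    proof
      show "p \<le> y" if "\<forall>n. s n \<le> y"
        by (rule LIMSEQ_le_const2[OF s_lim]) (use that in blast)
      show "\<forall>n. s n \<le> y" if "p \<le> y"
        using s_bounds(2) that by (meson less_imp_le order_trans)
    qed
    then show ?thesis
      by (auto simp: S_def set_eq_iff)
  qed
  \<comment> \<open>Both sides converge, the left one to \<open>p\<close> and the right one by
    continuity from above, so the inequality passes to the limit.\<close>
  have S_ge: "ennreal (s n) \<le> \<mu> (S n)" for n
    unfolding S_def
    using measure_gt_of_less_sugeno_pos[OF mu A f, of "s n"] s_bounds[of n] p
    by (simp add: ennreal_less_iff less_imp_le)
  show ?thesis
    by (rule LIMSEQ_le[OF tendsto_ennrealI[OF s_lim] S_lim[unfolded S_Inter]]) (use S_ge in blast)
qed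

text \<open>Every term of the supremum is bounded by the measure of a subset of \<open>A\<close>.
  Applied to H(f), this supplies the minimum with \<open>\<mu> A\<close> in the final bound.\<close>

lemma sugeno_pos_le_measure:
  assumes "monotone_measure M \<mu>" and "A \<in> sets M" and "f \<in> borel_measurable M"
  shows "sugeno_pos M \<mu> A f \<le> \<mu> A"
  unfolding sugeno_pos_eq_SUP
proof (rule SUP_least)
  fix t :: real
  have "\<mu> (A \<inter> {x \<in> space M. t \<le> f x}) \<le> \<mu> A"
    by (intro monotone_measureD[OF assms(1)] superlevel_sets assms) auto
  then show "min (ennreal t) (\<mu> (A \<inter> {x \<in> space M. t \<le> f x})) \<le> \<mu> A"
    by (rule min.coboundedI2)
qed

section \<open>Integrals of compositions with a nondecreasing function\<close>

lemma borel_measurable_mono_comp: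
  fixes H :: "real \<Rightarrow> real"
  assumes "mono H" and "f \<in> borel_measurable M"
  shows "(\<lambda>x. H (f x)) \<in> borel_measurable M"
  using measurable_compose[OF assms(2) borel_measurable_mono[OF assms(1)]] .

lemma sugeno_pos_mono_comp_le:
  assumes mu: "monotone_measure M \<mu>" and cont: "continuous_set_function M \<mu>"
    and A: "A \<in> sets M" and f: "f \<in> borel_measurable M" and H: "mono H"
    and p: "sugeno_pos M \<mu> A f = ennreal p" "0 \<le> p"
  shows "sugeno_pos M \<mu> A (\<lambda>x. H (f x)) \<le> ennreal (max (H p) p)"
  unfolding sugeno_pos_eq_SUP
proof (rule SUP_least)
  fix t :: real
  have Hf: "(\<lambda>x. H (f x)) \<in> borel_measurable M"
    by (rule borel_measurable_mono_comp[OF H f])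
  show "min (ennreal t) (\<mu> (A \<inter> {x \<in> space M. t \<le> H (f x)})) \<le> ennreal (max (H p) p)"
  proof (cases "t \<le> max (H p) p")
    case True
    then show ?thesis
      by (intro min.coboundedI1 ennreal_leI)
  next
    case False
    \<comment> \<open>If \<open>y \<le> p\<close>, monotonicity would give
      \<open>H y \<le> H p < t\<close>.\<close>
    have "p < y" if "t \<le> H y" for y
      using that False monoD[OF H, of y p] by force
    then have "\<mu> (A \<inter> {x \<in> space M. t \<le> H (f x)}) \<le> \<mu> (A \<inter> {x \<in> space M. p < f x})"
      by (intro monotone_measureD[OF mu] superlevel_sets A f Hf) auto
    also have "\<dots> \<le> ennreal p"
      by (rule measure_greater_sugeno_pos_le[OF cont A f p])
    also have "\<dots> \<le> ennreal (max (H p) p)"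
      by (intro ennreal_leI) simp
    finally show ?thesis
      by (rule min.coboundedI2)
  qed
qed

text \<open>The single level \<open>H p\<close> of the supremum suffices when \<open>p\<close> and
  \<open>H p\<close> are positive. Otherwise the minimum is nonpositive and \<open>ennreal\<close>
  sends it to 0.\<close>

lemma sugeno_pos_mono_comp_ge:
  assumes mu: "monotone_measure M \<mu>" and cont: "continuous_set_function M \<mu>"
    and A: "A \<in> sets M" and f: "f \<in> borel_measurable M" and H: "mono H"
    and p: "sugeno_pos M \<mu> A f = ennreal p" "0 \<le> p"
  shows "ennreal (min (H p) p) \<le> sugeno_pos M \<mu> A (\<lambda>x. H (f x))"
proof (cases "0 < p \<and> 0 < H p")
  case True
  then have pos: "0 < p" "0 < H p" by auto
  have Hf: "(\<lambda>x. H (f x)) \<in> borel_measurable M"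
    by (rule borel_measurable_mono_comp[OF H f])
  have "ennreal p \<le> \<mu> (A \<inter> {x \<in> space M. p \<le> f x})"
    by (rule sugeno_pos_le_measure_ge[OF mu cont A f p(1) pos(1)])
  also have "\<dots> \<le> \<mu> (A \<inter> {x \<in> space M. H p \<le> H (f x)})"
    using monoD[OF H] by (intro monotone_measureD[OF mu] superlevel_sets A f Hf) auto
  finally have p_le: "ennreal p \<le> \<mu> (A \<inter> {x \<in> space M. H p \<le> H (f x)})" .
  have "ennreal (min (H p) p)
      \<le> min (ennreal (H p)) (\<mu> (A \<inter> {x \<in> space M. H p \<le> H (f x)}))"
    by (intro min.boundedI order_trans[OF _ p_le] ennreal_leI) auto
  also have "\<dots> \<le> sugeno_pos M \<mu> A (\<lambda>x. H (f x))"
    using pos(2) by (rule sugeno_pos_upper)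
  finally show ?thesis .
next
  case False
  then have "min (H p) p \<le> 0" by auto
  then show ?thesis by (simp add: ennreal_neg)
qed

section \<open>Functions constant on a set and nonpositive off it, for the equality case\<close>

lemma sugeno_pos_two_valued:
  assumes mu: "monotone_measure M \<mu>" and A: "A \<in> sets M" and B: "B \<in> sets M" "B \<subseteq> A"
    and on_B: "\<And>x. x \<in> B \<Longrightarrow> f x = a" and off_B: "\<And>x. x \<notin> B \<Longrightarrow> f x \<le> 0"
  shows "sugeno_pos M \<mu> A f = min (ennreal a) (\<mu> B)"
proof (rule antisym)
  \<comment> \<open>At a positive level only points of \<open>B\<close> can qualify, and there
    \<open>f\<close> is constant; so the measure is \<open>\<mu> B\<close> up to level
    \<open>a\<close> and 0 above it. The supremum is attained at \<open>t = a\<close> when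
    \<open>a > 0\<close>.\<close>
  have level: "A \<inter> {x \<in> space M. t \<le> f x} = (if t \<le> a then B else {})" if "0 < t" for t
  proof -
    have "t \<le> f x \<longleftrightarrow> x \<in> B \<and> t \<le> a" for x
      using \<open>0 < t\<close> on_B[of x] off_B[of x] by force
    then show ?thesis
      using B sets.sets_into_space[OF B(1)] by auto
  qed
  show "sugeno_pos M \<mu> A f \<le> min (ennreal a) (\<mu> B)"
    unfolding sugeno_pos_eq_SUP
  proof (rule SUP_least)
    fix t :: real assume "t \<in> {0<..}"
    then show "min (ennreal t) (\<mu> (A \<inter> {x \<in> space M. t \<le> f x})) \<le> min (ennreal a) (\<mu> B)"
      using mu by (auto simp: level monotone_measure_def intro: min.coboundedI1 ennreal_leI)
  qed
  show "min (ennreal a) (\<mu> B) \<le> sugeno_pos M \<mu> A f"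
  proof (cases "0 < a")
    case True
    then show ?thesis
      using sugeno_pos_upper[OF True, of \<mu> A M f] by (simp add: level)
  next
    case False
    then show ?thesis by (simp add: ennreal_neg)
  qed
qed

theorem theorem4p1:
  fixes M :: "'a measure"
    and \<mu> :: "'a set \<Rightarrow> ennreal"
    and A :: "'a set"
    and star :: "real \<Rightarrow> real \<Rightarrow> real"
    and H :: "real \<Rightarrow> real"
  assumes "monotone_measure M \<mu>"
    and "continuous_set_function M \<mu>"
    and "A \<in> sets M"
    and "nondecreasing_star star"
    and "mono H"
    and "H 0 = 0"
  shows
    "(\<forall>f :: 'a \<Rightarrow> real.
        sym_sugeno_integrable M \<mu> A f \<longrightarrow>
        enn2ereal (sugeno_pos M \<mu> A f) \<le> (SUP y. ereal (H y)) \<longrightarrow>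
        sym_sugeno_integrable M \<mu> A (\<lambda>x. H (f x)) \<and>
        (let p1 = enn2real (sugeno_pos M \<mu> A f);
             p2 = enn2real (sugeno_neg M \<mu> A f)
         in sym_sugeno star M \<mu> A (\<lambda>x. H (f x))
              \<le> star (enn2real (min (ennreal (max (H p1) p1)) (\<mu> A)))
                     (max (H (- p2)) (- p2))))
     \<and>
     (\<forall>(B :: 'a set) (f :: 'a \<Rightarrow> real).
        B \<in> sets M \<longrightarrow> B \<subseteq> A \<longrightarrow> \<mu> B < \<infinity> \<longrightarrow> \<mu> (A - B) < \<infinity> \<longrightarrow>
        H (enn2real (\<mu> B)) = enn2real (\<mu> B) \<longrightarrow>
        f = (\<lambda>x. enn2real (\<mu> B) * indicator B x - enn2real (\<mu> (A - B)) * indicator (A - B) x) \<longrightarrow>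
        sym_sugeno_integrable M \<mu> A f \<and>
        enn2ereal (sugeno_pos M \<mu> A f) \<le> (SUP y. ereal (H y)) \<and>
        (let p1 = enn2real (sugeno_pos M \<mu> A f);
             p2 = enn2real (sugeno_neg M \<mu> A f)
         in sym_sugeno star M \<mu> A (\<lambda>x. H (f x))
              = star (enn2real (min (ennreal (max (H p1) p1)) (\<mu> A)))
                     (max (H (- p2)) (- p2))))"
proof (rule conjI)
  define G where "G y = - H (- y)" for y
  have G: "mono G"
    using \<open>mono H\<close> by (auto simp: G_def mono_def)
  have H_nonneg: "0 \<le> H y" if "0 \<le> y" for y
    using monoD[OF \<open>mono H\<close> that] \<open>H 0 = 0\<close> by simp
  have H_nonpos: "H y \<le> 0" if "y \<le> 0" for y
    using monoD[OF \<open>mono H\<close> that] \<open>H 0 = 0\<close> by simp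
  have star_mono: "star a b \<le> star c d"
    if "0 \<le> a" "a \<le> c" "b \<le> d" "d \<le> 0" for a b c d
    using \<open>nondecreasing_star star\<close> that unfolding nondecreasing_star_def by simp
  show "\<forall>f. sym_sugeno_integrable M \<mu> A f \<longrightarrow>
      enn2ereal (sugeno_pos M \<mu> A f) \<le> (SUP y. ereal (H y)) \<longrightarrow>
      sym_sugeno_integrable M \<mu> A (\<lambda>x. H (f x)) \<and>
      (let p1 = enn2real (sugeno_pos M \<mu> A f);
           p2 = enn2real (sugeno_neg M \<mu> A f)
       in sym_sugeno star M \<mu> A (\<lambda>x. H (f x))
            \<le> star (enn2real (min (ennreal (max (H p1) p1)) (\<mu> A)))
                   (max (H (- p2)) (- p2)))"
  proof (intro allI impI)
    fix f :: "'a \<Rightarrow> real"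
    assume int: "sym_sugeno_integrable M \<mu> A f"
    define p1 where "p1 = enn2real (sugeno_pos M \<mu> A f)"
    define p2 where "p2 = enn2real (sugeno_neg M \<mu> A f)"
    define q1 where "q1 = sugeno_pos M \<mu> A (\<lambda>x. H (f x))"
    define q2 where "q2 = sugeno_neg M \<mu> A (\<lambda>x. H (f x))"
    have f: "f \<in> borel_measurable M" and nf: "(\<lambda>x. - f x) \<in> borel_measurable M"
      using int by (auto simp: sym_sugeno_integrable_def)
    have p1: "sugeno_pos M \<mu> A f = ennreal p1" "0 \<le> p1"
      using int by (auto simp: p1_def sym_sugeno_integrable_def)
    have p2: "sugeno_pos M \<mu> A (\<lambda>x. - f x) = ennreal p2" "0 \<le> p2"
      using int by (auto simp: p2_def sym_sugeno_integrable_def sugeno_neg_eq_sugeno_pos)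
    have Hf: "(\<lambda>x. H (f x)) \<in> borel_measurable M"
      by (rule borel_measurable_mono_comp[OF \<open>mono H\<close> f])
    have q2_eq: "q2 = sugeno_pos M \<mu> A (\<lambda>x. G (- f x))"
      by (simp add: q2_def sugeno_neg_eq_sugeno_pos G_def)
    have q1_le: "q1 \<le> min (ennreal (max (H p1) p1)) (\<mu> A)"
      unfolding q1_def
      using sugeno_pos_mono_comp_le[OF assms(1-3) f \<open>mono H\<close> p1]
        sugeno_pos_le_measure[OF assms(1,3) Hf] by simp
    have q2_le: "q2 \<le> ennreal (max (G p2) p2)"
      unfolding q2_eq by (rule sugeno_pos_mono_comp_le[OF assms(1-3) nf G p2])
    \<comment> \<open>The integral of the negative part enters the star with a minus sign, so an
      upper bound for the star needs this lower bound; the preceding upper bound serves to make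
      \<open>q2\<close> finite.\<close>
    have q2_ge: "ennreal (min (G p2) p2) \<le> q2"
      unfolding q2_eq by (rule sugeno_pos_mono_comp_ge[OF assms(1-3) nf G p2])
    \<comment> \<open>Finiteness holds even if \<open>\<mu> A\<close> is infinite. It matters
      because \<open>enn2real\<close> sends infinity to 0 and is monotone only below
      infinity.\<close>
    have min_fin: "min (ennreal (max (H p1) p1)) (\<mu> A) < \<infinity>"
      by (simp add: min_less_iff_disj)
    have q1_fin: "q1 < \<infinity>"
      using q1_le min_fin by (rule le_less_trans)
    have q2_fin: "q2 < \<infinity>"
      using q2_le by (rule le_less_trans) simp
    have "enn2real q1 \<le> enn2real (min (ennreal (max (H p1) p1)) (\<mu> A))"
      using q1_le min_fin by (intro enn2real_mono) auto
    \<comment> \<open>Since \<open>G p2 = - H (- p2)\<close>, the right-hand side is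
      \<open>- min (G p2) p2\<close>, and this minimum is nonnegative.\<close>
    moreover have "- enn2real q2 \<le> max (H (- p2)) (- p2)"
      using enn2real_mono[OF q2_ge] q2_fin p2(2) H_nonpos[of "- p2"]
      by (auto simp: G_def min_def max_def split: if_splits)
    \<comment> \<open>Monotonicity of the star is available only for second arguments in its
      domain.\<close>
    moreover have "max (H (- p2)) (- p2) \<le> 0"
      using p2(2) H_nonpos[of "- p2"] by simp
    ultimately have "sym_sugeno star M \<mu> A (\<lambda>x. H (f x))
        \<le> star (enn2real (min (ennreal (max (H p1) p1)) (\<mu> A))) (max (H (- p2)) (- p2))"
      unfolding sym_sugeno_def q1_def[symmetric] q2_def[symmetric]
      by (intro star_mono) auto
    moreover have "sym_sugeno_integrable M \<mu> A (\<lambda>x. H (f x))"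
      using Hf q1_fin q2_fin by (simp add: sym_sugeno_integrable_def q1_def q2_def)
    ultimately show "sym_sugeno_integrable M \<mu> A (\<lambda>x. H (f x)) \<and>
      (let p1 = enn2real (sugeno_pos M \<mu> A f);
           p2 = enn2real (sugeno_neg M \<mu> A f)
       in sym_sugeno star M \<mu> A (\<lambda>x. H (f x))
            \<le> star (enn2real (min (ennreal (max (H p1) p1)) (\<mu> A)))
                   (max (H (- p2)) (- p2)))"
      by (simp add: Let_def p1_def p2_def)
  qed
  show "\<forall>(B :: 'a set) (f :: 'a \<Rightarrow> real).
      B \<in> sets M \<longrightarrow> B \<subseteq> A \<longrightarrow> \<mu> B < \<infinity> \<longrightarrow> \<mu> (A - B) < \<infinity> \<longrightarrow>
      H (enn2real (\<mu> B)) = enn2real (\<mu> B) \<longrightarrow>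
      f = (\<lambda>x. enn2real (\<mu> B) * indicator B x - enn2real (\<mu> (A - B)) * indicator (A - B) x) \<longrightarrow>
      sym_sugeno_integrable M \<mu> A f \<and>
      enn2ereal (sugeno_pos M \<mu> A f) \<le> (SUP y. ereal (H y)) \<and>
      (let p1 = enn2real (sugeno_pos M \<mu> A f);
           p2 = enn2real (sugeno_neg M \<mu> A f)
       in sym_sugeno star M \<mu> A (\<lambda>x. H (f x))
            = star (enn2real (min (ennreal (max (H p1) p1)) (\<mu> A)))
                   (max (H (- p2)) (- p2)))"
  proof (intro allI impI)
    fix B :: "'a set" and f :: "'a \<Rightarrow> real"
    assume B: "B \<in> sets M" "B \<subseteq> A" and fin: "\<mu> B < \<infinity>" "\<mu> (A - B) < \<infinity>"
      and Hb: "H (enn2real (\<mu> B)) = enn2real (\<mu> B)"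
      and f_eq: "f = (\<lambda>x. enn2real (\<mu> B) * indicator B x
        - enn2real (\<mu> (A - B)) * indicator (A - B) x)"
    define b where "b = enn2real (\<mu> B)"
    define c where "c = enn2real (\<mu> (A - B))"
    have b: "\<mu> B = ennreal b" "0 \<le> b" and c: "\<mu> (A - B) = ennreal c" "0 \<le> c"
      using fin by (auto simp: b_def c_def)
    have "H b = b"
      using Hb by (simp add: b_def)
    have C: "A - B \<in> sets M" "A - B \<subseteq> A"
      using B \<open>A \<in> sets M\<close> by auto
    have f_on: "f x = b" if "x \<in> B" for x
      using that by (simp add: f_eq b_def)
    have f_on': "f x = - c" if "x \<in> A - B" for x
      using that by (simp add: f_eq c_def)
    have f_nonpos: "f x \<le> 0" if "x \<notin> B" for x
      using that by (simp add: f_eq)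
    have f_nonneg: "0 \<le> f x" if "x \<notin> A - B" for x
      using that by (simp add: f_eq)
    have f: "f \<in> borel_measurable M"
      unfolding f_eq using B C by measurable
    \<comment> \<open>The height of \<open>f\<close> on \<open>B\<close> equals the measure of
      \<open>B\<close>, so the minimum collapses to \<open>b\<close>. The same happens for the
      negative part on \<open>A - B\<close> with \<open>c\<close>.\<close>
    have "sugeno_pos M \<mu> A f = min (ennreal b) (\<mu> B)"
      by (rule sugeno_pos_two_valued[OF assms(1,3) B f_on f_nonpos])
    then have pos: "sugeno_pos M \<mu> A f = ennreal b"
      by (simp add: b)
    have "sugeno_neg M \<mu> A f = min (ennreal c) (\<mu> (A - B))"
      unfolding sugeno_neg_eq_sugeno_pos
      by (rule sugeno_pos_two_valued[OF assms(1,3) C]) (simp_all add: f_on' f_nonneg)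
    then have neg: "sugeno_neg M \<mu> A f = ennreal c"
      by (simp add: c)
    have "sugeno_pos M \<mu> A (\<lambda>x. H (f x)) = min (ennreal b) (\<mu> B)"
      by (rule sugeno_pos_two_valued[OF assms(1,3) B])
        (simp_all add: f_on f_nonpos H_nonpos \<open>H b = b\<close>)
    then have Hpos: "sugeno_pos M \<mu> A (\<lambda>x. H (f x)) = ennreal b"
      by (simp add: b)
    \<comment> \<open>Here the height changes to \<open>- H (- c)\<close> while the measure stays
      \<open>c\<close>; minus their minimum is exactly the second argument of the bound.\<close>
    have "sugeno_neg M \<mu> A (\<lambda>x. H (f x)) = min (ennreal (- H (- c))) (\<mu> (A - B))"
      unfolding sugeno_neg_eq_sugeno_pos
      by (rule sugeno_pos_two_valued[OF assms(1,3) C]) (simp_all add: f_on' f_nonneg H_nonneg)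
    then have Hneg: "sugeno_neg M \<mu> A (\<lambda>x. H (f x)) = ennreal (min (- H (- c)) c)"
      using H_nonpos[of "- c"] c by (simp add: min_ennreal)
    \<comment> \<open>With \<open>H b = b\<close> the maximum in the first argument is
      \<open>b\<close>, and this inequality removes the minimum with \<open>\<mu> A\<close>.\<close>
    have "\<mu> B \<le> \<mu> A"
      using \<open>monotone_measure M \<mu>\<close> B \<open>A \<in> sets M\<close> unfolding monotone_measure_def by simp
    then have min_b: "min (ennreal (max (H b) b)) (\<mu> A) = ennreal b"
      using b by (simp add: \<open>H b = b\<close> min_absorb1)
    have "- min (- H (- c)) c = max (H (- c)) (- c)" "0 \<le> min (- H (- c)) c"
      using H_nonpos[of "- c"] c by (auto simp: min_def max_def)
    then have "sym_sugeno star M \<mu> A (\<lambda>x. H (f x))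
        = star (enn2real (min (ennreal (max (H b) b)) (\<mu> A))) (max (H (- c)) (- c))"
      unfolding sym_sugeno_def Hpos Hneg min_b by (simp only: enn2real_ennreal)
    moreover have "sym_sugeno_integrable M \<mu> A f"
      using f by (simp add: sym_sugeno_integrable_def pos neg)
    \<comment> \<open>The fixed point \<open>b = H b\<close> is itself a value of
      \<open>H\<close>.\<close>
    moreover have "enn2ereal (ennreal b) \<le> (SUP y. ereal (H y))"
    proof -
      have "ereal (H b) \<le> (SUP y. ereal (H y))"
        by (rule SUP_upper) simp
      then show ?thesis
        using b by (simp add: \<open>H b = b\<close>)
    qed
    ultimately show "sym_sugeno_integrable M \<mu> A f \<and>
      enn2ereal (sugeno_pos M \<mu> A f) \<le> (SUP y. ereal (H y)) \<and>
      (let p1 = enn2real (sugeno_pos M \<mu> A f);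
           p2 = enn2real (sugeno_neg M \<mu> A f)
       in sym_sugeno star M \<mu> A (\<lambda>x. H (f x))
            = star (enn2real (min (ennreal (max (H p1) p1)) (\<mu> A)))
                   (max (H (- p2)) (- p2)))"
      using b c by (simp add: Let_def pos neg)
  qed
qed

end
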